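(* Let $d\ge 1$ and let $p:\mathbb{R}^d\to[0,\infty)$ be a probability density function that is four times differentiable with bounded derivatives of order $4$. Let $X_1,X_2,\dots$ be independent and identically distributed with density $p$. Let $0<a_1<a_2$ be fixed constants and, for each $n\ge 1$, put $h_i=a_i\,n^{-1/(d+8)}$ for $i=1,2$. Let $c_1,c_2$ be the unique real numbers with $c_1+c_2=1$ and $c_1h_1^2+c_2h_2^2=0$, and let $\hat p_{n,2}(x)=c_1\hat p_{n,h_1}(x)+c_2\hat p_{n,h_2}(x)$, where $\hat p_{n,h}$ is the Gaussian kernel density estimator with bandwidth $h$ built from $X_1,\dots,X_n$. Then for every $x\in\mathbb{R}^d$, $$\mathbb{E}\big[(\hat p_{n,2}(x)-p(x))^2\big]=O\big(n^{-8/(d+8)}\big)\qquad\text{as } n\to\infty.$$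
   Context: The Gaussian kernel density estimator with bandwidth $h>0$ built from a sample $X_1,\dots,X_n\in\mathbb{R}^d$ is $$\hat p_{n,h}(x)=\frac{1}{nh^d}\sum_{i=1}^n\frac{e^{-(\|x-X_i\|/h)^2/2}}{(2\pi)^{d/2}},\qquad x\in\mathbb{R}^d,$$ with $\|\cdot\|$ the Euclidean norm. *)

theory Defs
  imports "HOL-Probability.Probability" "HOL-Library.Landau_Symbols"
begin

definition gaussian_kde ::
    "(nat \<Rightarrow> 'a::euclidean_space) \<Rightarrow> nat \<Rightarrow> real \<Rightarrow> 'a \<Rightarrow> real" where
  "gaussian_kde X n h x =
     1 / (real n * h ^ DIM('a)) *
     (\<Sum>i=1..n. exp (- (norm (x - X i) / h)\<^sup>2 / 2) / (2 * pi) powr (real DIM('a) / 2))"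

definition kde_weights :: "real \<Rightarrow> real \<Rightarrow> real \<times> real" where
  "kde_weights h1 h2 =
     (THE c. fst c + snd c = 1 \<and> fst c * h1\<^sup>2 + snd c * h2\<^sup>2 = 0)"

lemma kde_weights_ex1:
  assumes "h1\<^sup>2 \<noteq> h2\<^sup>2"
  shows "\<exists>!c::real \<times> real. fst c + snd c = 1 \<and> fst c * h1\<^sup>2 + snd c * h2\<^sup>2 = 0"
proof -
  define a b where "a = h1\<^sup>2" and "b = h2\<^sup>2"
  have ab: "b - a \<noteq> 0" using assms by (simp add: a_def b_def)
  have "\<exists>!c::real \<times> real. fst c + snd c = 1 \<and> fst c * a + snd c * b = 0"
  proof (rule ex1I)
    have "b / (b - a) - a / (b - a) = 1"
      using ab by (simp flip: diff_divide_distrib)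
    then show "fst (b / (b - a), - a / (b - a)) + snd (b / (b - a), - a / (b - a)) = 1 \<and>
        fst (b / (b - a), - a / (b - a)) * a + snd (b / (b - a), - a / (b - a)) * b = 0"
      by (simp add: mult.commute)
  next
    fix c :: "real \<times> real"
    assume c: "fst c + snd c = 1 \<and> fst c * a + snd c * b = 0"
    then have s: "snd c = 1 - fst c" by simp
    have "fst c * (b - a) = b" using c unfolding s by (simp add: algebra_simps)
    then have f: "fst c = b / (b - a)" using ab by (simp add: field_simps)
    show "c = (b / (b - a), - a / (b - a))"
      using ab s f by (simp add: prod_eq_iff divide_simps)
  qed
  then show ?thesis by (simp only: a_def b_def)
qed

definition combined_kde ::
    "(nat \<Rightarrow> 'a::euclidean_space) \<Rightarrow> nat \<Rightarrow> real \<Rightarrow> real \<Rightarrow> 'a \<Rightarrow> real" where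
  "combined_kde X n h1 h2 x =
     fst (kde_weights h1 h2) * gaussian_kde X n h1 x +
     snd (kde_weights h1 h2) * gaussian_kde X n h2 x"

text \<open>Four times Frechet differentiable on the whole space, the k-th derivative being
  regarded as a map into the k-fold iterated space of bounded linear maps. Boundedness of the
  fourth derivative in operator norm amounts to boundedness of all partial derivatives of
  order 4, as the space is finite dimensional.\<close>

definition four_times_differentiable_bounded :: "('a::euclidean_space \<Rightarrow> real) \<Rightarrow> bool" where
  "four_times_differentiable_bounded p \<longleftrightarrow>
     (\<exists>(D1 :: 'a \<Rightarrow> 'a \<Rightarrow>\<^sub>L real)
       (D2 :: 'a \<Rightarrow> 'a \<Rightarrow>\<^sub>L 'a \<Rightarrow>\<^sub>L real)
       (D3 :: 'a \<Rightarrow> 'a \<Rightarrow>\<^sub>L 'a \<Rightarrow>\<^sub>L 'a \<Rightarrow>\<^sub>L real)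
       (D4 :: 'a \<Rightarrow> 'a \<Rightarrow>\<^sub>L 'a \<Rightarrow>\<^sub>L 'a \<Rightarrow>\<^sub>L 'a \<Rightarrow>\<^sub>L real).
        (\<forall>x. (p has_derivative blinfun_apply (D1 x)) (at x)) \<and>
        (\<forall>x. (D1 has_derivative blinfun_apply (D2 x)) (at x)) \<and>
        (\<forall>x. (D2 has_derivative blinfun_apply (D3 x)) (at x)) \<and>
        (\<forall>x. (D3 has_derivative blinfun_apply (D4 x)) (at x)) \<and>
        bounded (range D4))"

end

(* The error splits into variance plus squared bias. Substituting y = x + h z, the mean of an
   estimator with bandwidth h is the integral of gauss z * p (x + h z). In the fourth order Taylor
   expansion of p at x the odd terms integrate to zero by symmetry, so the bias is
   mu h^2 + O(h^4), and the weights cancel the h^2 terms. For the variance, the kernel is at most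
   gauss 0 / h^d, so its second moment is at most that times its mean, which is bounded near
   h = 0 by the bias expansion; hence p itself need not be bounded a priori. With
   r = n powr (-1 / (d + 8)), both r^(-d) / n and (r^4)^2 equal r^8. *)

theory Submission
  imports Defs
begin


section \<open>Affine substitution and the standard Gaussian density\<close>

text \<open>Lebesgue measure is its own image under an affine scaling, up to the constant density
  |c|^d. The factor \<open>c\<close> is later 1 / sqrt 2 for a domination, -1 for a reflection, and
  the bandwidth for the kernel.\<close>

lemma lborel_integral_affine:
  fixes f :: "'a::euclidean_space \<Rightarrow> real"
  assumes [measurable]: "f \<in> borel_measurable borel" and c: "c \<noteq> 0"
  shows "integrable lborel f \<longleftrightarrow> integrable lborel (\<lambda>z. f (t + c *\<^sub>R z))"
    and "(\<integral>y. f y \<partial>lborel) = \<bar>c\<bar> ^ DIM('a) * (\<integral>z. f (t + c *\<^sub>R z) \<partial>lborel)"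
proof -
  have "integrable lborel f \<longleftrightarrow> integrable lborel (\<lambda>z. \<bar>c\<bar> ^ DIM('a) * f (t + c *\<^sub>R z))"
    by (subst lborel_affine[OF c, of t]) (simp add: integrable_density integrable_distr_eq)
  then show "integrable lborel f \<longleftrightarrow> integrable lborel (\<lambda>z. f (t + c *\<^sub>R z))"
    using c by simp
  show "(\<integral>y. f y \<partial>lborel) = \<bar>c\<bar> ^ DIM('a) * (\<integral>z. f (t + c *\<^sub>R z) \<partial>lborel)"
    by (subst lborel_affine[OF c, of t]) (simp add: integral_density integral_distr)
qed

definition gauss :: "'a::euclidean_space \<Rightarrow> real" where
  "gauss z = exp (- (norm z)\<^sup>2 / 2) / (2 * pi) powr (real DIM('a) / 2)"

lemma gauss_pos: "0 < gauss z"
  by (simp add: gauss_def)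

lemma gauss_le_gauss_0: "gauss (z :: 'a::euclidean_space) \<le> gauss (0 :: 'a)"
  by (simp add: gauss_def divide_right_mono)

lemma gauss_minus [simp]: "gauss (- z) = gauss z"
  by (simp add: gauss_def)

lemma borel_measurable_gauss [measurable]: "gauss \<in> borel_measurable borel"
  unfolding gauss_def by measurable

text \<open>The squared norm is the sum of the squared coordinates, so the exponential factorizes.
  This reduces the total mass of \<open>gauss\<close> to dimension one.\<close>

lemma gauss_eq_prod_std_normal_density:
  fixes z :: "'a::euclidean_space"
  shows "gauss z = (\<Prod>b\<in>Basis. std_normal_density (z \<bullet> b))"
proof -
  have "(norm z)\<^sup>2 = (\<Sum>b\<in>Basis. (z \<bullet> b)\<^sup>2)"
    unfolding power2_norm_eq_inner euclidean_inner[of z z] by (simp add: power2_eq_square)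
  then have "exp (- (norm z)\<^sup>2 / 2) = (\<Prod>b\<in>Basis. exp (- (z \<bullet> b)\<^sup>2 / 2))"
    by (simp add: exp_sum[symmetric] sum_negf sum_divide_distrib)
  moreover have "(2 * pi) powr (real DIM('a) / 2) = sqrt (2 * pi) ^ DIM('a)"
    by (simp add: powr_half_sqrt[symmetric] powr_realpow[symmetric] powr_powr)
  ultimately show ?thesis
    by (simp add: gauss_def std_normal_density_def prod_dividef)
qed

lemma has_bochner_integral_gauss: "has_bochner_integral lborel (gauss :: 'a::euclidean_space \<Rightarrow> real) 1"
proof (rule has_bochner_integral_nn_integral)
  have "(\<integral>\<^sup>+ z. ennreal (gauss (z :: 'a)) \<partial>lborel)
      = (\<integral>\<^sup>+ z. (\<Prod>b\<in>Basis. ennreal (std_normal_density (z \<bullet> b))) \<partial>(lborel :: 'a measure))"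
    by (simp add: gauss_eq_prod_std_normal_density prod_ennreal)
  also have "\<dots> = (\<Prod>b\<in>(Basis::'a set). \<integral>\<^sup>+ t. ennreal (std_normal_density t) \<partial>lborel)"
    by (rule nn_integral_lborel_prod) auto
  also have "\<dots> = 1"
    by (simp add: nn_integral_eq_integral)
  finally show "(\<integral>\<^sup>+ z. ennreal (gauss (z :: 'a)) \<partial>lborel) = ennreal 1" by simp
qed (use gauss_pos in \<open>auto intro: less_imp_le\<close>)

text \<open>Half of the exponent absorbs the polynomial factor; what remains is a constant multiple
  of a Gaussian stretched by sqrt 2, integrable by affine substitution.\<close>

lemma gauss_fourth_moment_integrable:
  "integrable lborel (\<lambda>z::'a::euclidean_space. gauss z * norm z ^ 4)"
proof (rule Bochner_Integration.integrable_bound)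
  have "integrable lborel (\<lambda>z::'a. gauss (0 + (1 / sqrt 2) *\<^sub>R z))"
    using has_bochner_integral_gauss[where 'a='a]
    by (intro iffD1[OF lborel_integral_affine(1)]) (auto simp: has_bochner_integral_iff)
  then show "integrable lborel (\<lambda>z::'a. 32 * gauss ((1 / sqrt 2) *\<^sub>R z))" by simp
  show "AE z in lborel. norm (gauss (z::'a) * norm z ^ 4) \<le> norm (32 * gauss ((1 / sqrt 2) *\<^sub>R z))"
  proof (rule AE_I2)
    fix z :: 'a
    define s where "s = (norm z)\<^sup>2"
    have s: "0 \<le> s" by (simp add: s_def)
    \<comment> \<open>Keeping only the quadratic term of the exponential series gives s^2 / 32, the
      source of the constant 32.\<close>
    have "(s / 4)\<^sup>2 / 2 \<le> exp (s / 4)"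
      using exp_lower_Taylor_quadratic[of "s / 4"] s by simp
    then have "exp (- s / 2) * s\<^sup>2 \<le> exp (- s / 2) * (32 * exp (s / 4))"
      by (intro mult_left_mono) (auto simp: power2_eq_square)
    also have "\<dots> = 32 * exp (- s / 4)"
      by (simp add: exp_add[symmetric])
    finally have *: "exp (- s / 2) * s\<^sup>2 \<le> 32 * exp (- s / 4)" .
    have "gauss z * norm z ^ 4 = exp (- s / 2) * s\<^sup>2 / (2 * pi) powr (real DIM('a) / 2)"
      by (simp add: gauss_def s_def power_mult[symmetric])
    also have "\<dots> \<le> 32 * exp (- s / 4) / (2 * pi) powr (real DIM('a) / 2)"
      using * by (rule divide_right_mono) simp
    also have "\<dots> = 32 * gauss ((1 / sqrt 2) *\<^sub>R z)"
      by (simp add: gauss_def s_def power_divide)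
    finally show "norm (gauss z * norm z ^ 4) \<le> norm (32 * gauss ((1 / sqrt 2) *\<^sub>R z))"
      using gauss_pos[of z] gauss_pos[of "(1 / sqrt 2) *\<^sub>R z"] by simp
  qed
qed measurable

text \<open>Domination by the total mass and the fourth moment. This single growth condition serves
  every term of the Taylor expansion.\<close>

lemma gauss_integrable_mult:
  fixes f :: "'a::euclidean_space \<Rightarrow> real"
  assumes [measurable]: "f \<in> borel_measurable borel"
    and bound: "\<And>z. \<bar>f z\<bar> \<le> C * (1 + norm z ^ 4)"
  shows "integrable lborel (\<lambda>z. gauss z * f z)"
proof (rule Bochner_Integration.integrable_bound)
  show "integrable lborel (\<lambda>z::'a. C * (gauss z + gauss z * norm z ^ 4))"
    using has_bochner_integral_gauss[where 'a='a] gauss_fourth_moment_integrable[where 'a='a]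
    by (simp add: has_bochner_integral_iff)
  show "AE z in lborel. norm (gauss z * f z) \<le> norm (C * (gauss z + gauss z * norm z ^ 4))"
  proof (rule AE_I2)
    fix z :: 'a
    have "\<bar>gauss z * f z\<bar> \<le> gauss z * (C * (1 + norm z ^ 4))"
      using gauss_pos[of z] bound[of z] by (simp add: abs_mult)
    then show "norm (gauss z * f z) \<le> norm (C * (gauss z + gauss z * norm z ^ 4))"
      by (simp add: algebra_simps)
  qed
qed measurable

text \<open>Reflection in the origin preserves both Lebesgue measure and \<open>gauss\<close>, so
  the integral equals its own negative.\<close>

lemma integral_gauss_mult_odd:
  fixes f :: "'a::euclidean_space \<Rightarrow> real"
  assumes [measurable]: "f \<in> borel_measurable borel" and odd: "\<And>z. f (- z) = - f z"
  shows "(\<integral>z. gauss z * f z \<partial>lborel) = 0"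
proof -
  have "(\<integral>z. gauss z * f z \<partial>lborel) = - (\<integral>z. gauss z * f z \<partial>lborel)"
    by (subst lborel_integral_affine(2)[where c="-1" and t=0]) (simp_all add: odd)
  then show ?thesis by simp
qed

section \<open>Fourth order Taylor expansion with a global remainder bound\<close>

text \<open>\<open>L\<close> collects the odd terms, of orders 1 and 3, and \<open>Q\<close> is the quadratic term. Only the
  existence of the fourth derivative is available, not its continuity, hence the Lagrange remainder.\<close>
lemma four_times_differentiable_bounded_Taylor:
  fixes p :: "'a::euclidean_space \<Rightarrow> real"
  assumes "four_times_differentiable_bounded p"
  obtains L Q C where
    "L \<in> borel_measurable borel" "\<And>v. L (- v) = - L v" "\<And>v. \<bar>L v\<bar> \<le> C * (1 + norm v ^ 4)"
    "Q \<in> borel_measurable borel" "\<And>c v. Q (c *\<^sub>R v) = c\<^sup>2 * Q v" "\<And>v. \<bar>Q v\<bar> \<le> C * (1 + norm v ^ 4)"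
    "\<And>v. \<bar>p (x + v) - p x - L v - Q v\<bar> \<le> C * norm v ^ 4"
    "0 \<le> C"
proof -
  obtain D1 D2 D3 D4 where D:
    "\<And>x. (p has_derivative blinfun_apply (D1 x)) (at x)"
    "\<And>x. (D1 has_derivative blinfun_apply (D2 x)) (at x)"
    "\<And>x. (D2 has_derivative blinfun_apply (D3 x)) (at x)"
    "\<And>x. (D3 has_derivative blinfun_apply (D4 x)) (at x)"
    and "bounded (range D4)"
    using assms unfolding four_times_differentiable_bounded_def by metis
  from \<open>bounded (range D4)\<close> obtain B where B: "\<And>x. norm (D4 x) \<le> B"
    by (auto simp: bounded_iff)
  have B0: "0 \<le> B" using B[of 0] norm_ge_zero order_trans by blast
  define L where "L v = D1 x v + D3 x v v v / 6" for v
  define Q where "Q v = D2 x v v / 2" for v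
  have n1: "\<bar>D1 x v\<bar> \<le> norm (D1 x) * norm v" for v
    using norm_blinfun[of "D1 x" v] by simp
  have n2: "\<bar>D2 x v v\<bar> \<le> norm (D2 x) * norm v ^ 2" for v
    using order_trans[OF norm_blinfun[of "D2 x v" v] mult_right_mono[OF norm_blinfun[of "D2 x" v] norm_ge_zero]]
    by (simp add: power2_eq_square mult.assoc)
  have n3: "\<bar>D3 x v v v\<bar> \<le> norm (D3 x) * norm v ^ 3" for v
    using order_trans[OF norm_blinfun[of "D3 x v v" v] mult_right_mono[OF
        order_trans[OF norm_blinfun[of "D3 x v" v] mult_right_mono[OF norm_blinfun[of "D3 x" v] norm_ge_zero]] norm_ge_zero]]
    by (simp add: power3_eq_cube mult.assoc)
  have n4: "\<bar>D4 y v v v v\<bar> \<le> B * norm v ^ 4" for y v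
  proof -
    have "norm (D4 y v v v v) \<le> norm (D4 y v v v) * norm v" by (rule norm_blinfun)
    also have "\<dots> \<le> (norm (D4 y v v) * norm v) * norm v" by (intro mult_right_mono norm_blinfun) auto
    also have "\<dots> \<le> ((norm (D4 y v) * norm v) * norm v) * norm v" by (intro mult_right_mono norm_blinfun) auto
    also have "\<dots> \<le> (((norm (D4 y) * norm v) * norm v) * norm v) * norm v" by (intro mult_right_mono norm_blinfun) auto
    also have "\<dots> \<le> (((B * norm v) * norm v) * norm v) * norm v" by (intro mult_right_mono B) auto
    finally show ?thesis by (simp add: power4_eq_xxxx mult.assoc)
  qed
  have Taylor: "\<bar>p (x + v) - p x - L v - Q v\<bar> \<le> B / 24 * norm v ^ 4" for v
  proof -
    \<comment> \<open>Restricting p to the segment from x to x + v reduces the claim to one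
      variable: the m-th derivative in t is the m-th Frechet derivative evaluated at m copies of
      v.\<close>
    define diff :: "nat \<Rightarrow> real \<Rightarrow> real" where
      "diff = (\<lambda>m t. if m = 0 then p (x + t *\<^sub>R v) else if m = 1 then D1 (x + t *\<^sub>R v) v
         else if m = 2 then D2 (x + t *\<^sub>R v) v v else if m = 3 then D3 (x + t *\<^sub>R v) v v v
         else D4 (x + t *\<^sub>R v) v v v v)"
    have line: "((\<lambda>t. x + t *\<^sub>R v) has_derivative (\<lambda>s. s *\<^sub>R v)) (at t)" for t
      by (auto intro!: derivative_eq_intros)
    note d = has_derivative_compose[OF line]
    have d0: "(diff 0 has_real_derivative diff (Suc 0) t) (at t)" for t
      unfolding diff_def has_field_derivative_def
      using d[OF D(1)] by (simp add: blinfun.scaleR_right mult_commute_abs)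
    have d1: "(diff 1 has_real_derivative diff (Suc 1) t) (at t)" for t
      unfolding diff_def has_field_derivative_def
      by (auto intro!: derivative_eq_intros d[OF D(2)] simp: blinfun.scaleR_right blinfun.scaleR_left)
    have d2: "(diff 2 has_real_derivative diff (Suc 2) t) (at t)" for t
      unfolding diff_def has_field_derivative_def
      by (auto intro!: derivative_eq_intros d[OF D(3)] simp: blinfun.scaleR_right blinfun.scaleR_left)
    have d3: "(diff 3 has_real_derivative diff (Suc 3) t) (at t)" for t
      unfolding diff_def has_field_derivative_def
      by (auto intro!: derivative_eq_intros d[OF D(4)] simp: blinfun.scaleR_right blinfun.scaleR_left)
    have "m < 4 \<longrightarrow> m = 0 \<or> m = 1 \<or> m = 2 \<or> m = 3" for m :: nat by arith
    then have "\<forall>m t. m < 4 \<and> 0 \<le> t \<and> t \<le> 1 \<longrightarrow> (diff m has_real_derivative diff (Suc m) t) (at t)"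
      using d0 d1 d2 d3 by metis
    from Maclaurin[of 1 4 diff "diff 0", OF _ _ refl this]
    obtain t where "diff 0 1 = (\<Sum>m<4. diff m 0 / fact m * 1 ^ m) + diff 4 t / fact 4 * 1 ^ 4"
      by auto
    then have remainder: "p (x + v) - p x - L v - Q v = D4 (x + t *\<^sub>R v) v v v v / 24"
      by (simp add: numeral_eq_Suc diff_def L_def Q_def fact_numeral)
    show ?thesis unfolding remainder using n4[of "x + t *\<^sub>R v" v] by simp
  qed
  \<comment> \<open>Lower powers are absorbed, so that \<open>L\<close> and \<open>Q\<close> meet
    the growth condition of \<open>gauss_integrable_mult\<close>.\<close>
  have pow: "norm v ^ k \<le> 1 + norm v ^ 4" if "k \<le> 4" for k and v :: 'a
  proof (cases "norm v \<le> 1")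
    case True
    then have "norm v ^ k \<le> 1" by (simp add: power_le_one)
    then show ?thesis by (simp add: add_increasing2)
  next
    case False
    then have "norm v ^ k \<le> norm v ^ 4" using that by (intro power_increasing) auto
    then show ?thesis by simp
  qed
  define C where "C = norm (D1 x) + norm (D2 x) + norm (D3 x) + B / 24"
  show thesis
  proof (rule that[of L C Q])
    show "L \<in> borel_measurable borel" "Q \<in> borel_measurable borel"
      unfolding L_def Q_def
      by (auto intro!: borel_measurable_continuous_onI continuous_intros)
    show "L (- v) = - L v" "Q (c *\<^sub>R v) = c\<^sup>2 * Q v" for c v
      by (simp_all add: L_def Q_def blinfun.minus_right blinfun.minus_left blinfun.scaleR_right
          blinfun.scaleR_left power2_eq_square)
    show C0: "0 \<le> C" using B0 by (simp add: C_def)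
    show "\<bar>L v\<bar> \<le> C * (1 + norm v ^ 4)" for v
    proof -
      have "\<bar>L v\<bar> \<le> norm (D1 x) * norm v ^ 1 + norm (D3 x) * norm v ^ 3"
        using n1[of v] n3[of v] by (simp add: L_def)
      also have "\<dots> \<le> norm (D1 x) * (1 + norm v ^ 4) + norm (D3 x) * (1 + norm v ^ 4)"
        by (intro add_mono mult_left_mono pow) auto
      also have "\<dots> \<le> C * (1 + norm v ^ 4)"
        unfolding C_def distrib_right[symmetric] using B0 by (intro mult_right_mono) auto
      finally show ?thesis .
    qed
    show "\<bar>Q v\<bar> \<le> C * (1 + norm v ^ 4)" for v
    proof -
      have "\<bar>Q v\<bar> \<le> norm (D2 x) * norm v ^ 2"
        using n2[of v] by (simp add: Q_def)
      also have "\<dots> \<le> norm (D2 x) * (1 + norm v ^ 4)"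
        by (intro mult_left_mono pow) auto
      also have "\<dots> \<le> C * (1 + norm v ^ 4)"
        unfolding C_def using B0 by (intro mult_right_mono) auto
      finally show ?thesis .
    qed
    show "\<bar>p (x + v) - p x - L v - Q v\<bar> \<le> C * norm v ^ 4" for v
      by (rule order_trans[OF Taylor mult_right_mono]) (simp_all add: C_def)
  qed
qed

lemma four_times_differentiable_bounded_borel_measurable:
  assumes "four_times_differentiable_bounded p"
  shows "p \<in> borel_measurable borel"
proof (rule borel_measurable_continuous_onI)
  have "p differentiable (at y)" for y
    using assms unfolding four_times_differentiable_bounded_def by (metis differentiableI)
  then show "continuous_on UNIV p"
    by (simp add: continuous_at_imp_continuous_on differentiable_imp_continuous_within)
qed


section \<open>Bias expansion for a single bandwidth\<close>

text \<open>Both constants are fixed before \<open>h\<close>: the weights can cancel the quadratic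
  terms only if the two bandwidths share the same \<mu>, and \<open>B\<close> must stay the same
  while the bandwidths shrink. Here \<mu> is the Gaussian mean of the quadratic Taylor term, and
  \<open>B\<close> is the remainder constant times the fourth moment.\<close>

lemma gauss_smoothing_expansion:
  fixes p :: "'a::euclidean_space \<Rightarrow> real"
  assumes "four_times_differentiable_bounded p"
  obtains \<mu> B where "0 \<le> B"
    "\<And>h. integrable lborel (\<lambda>z. gauss z * p (x + h *\<^sub>R z))"
    "\<And>h. \<bar>(\<integral>z. gauss z * p (x + h *\<^sub>R z) \<partial>lborel) - p x - \<mu> * h\<^sup>2\<bar> \<le> B * h ^ 4"
proof -
  obtain L Q C where
    L [measurable]: "L \<in> borel_measurable borel" and L_odd: "\<And>v. L (- v) = - L v"
    and L_bound: "\<And>v. \<bar>L v\<bar> \<le> C * (1 + norm v ^ 4)"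
    and Q [measurable]: "Q \<in> borel_measurable borel" and Q_hom: "\<And>c v. Q (c *\<^sub>R v) = c\<^sup>2 * Q v"
    and Q_bound: "\<And>v. \<bar>Q v\<bar> \<le> C * (1 + norm v ^ 4)"
    and R_bound: "\<And>v. \<bar>p (x + v) - p x - L v - Q v\<bar> \<le> C * norm v ^ 4"
    and C: "0 \<le> C"
    by (rule four_times_differentiable_bounded_Taylor[OF assms, of x]) blast
  note [measurable] = four_times_differentiable_bounded_borel_measurable[OF assms]
  define m4 where "m4 = (\<integral>z. gauss z * norm (z::'a) ^ 4 \<partial>lborel)"
  define \<mu> where "\<mu> = (\<integral>z. gauss z * Q z \<partial>lborel)"
  define R where "R v = p (x + v) - p x - L v - Q v" for v
  have [measurable]: "R \<in> borel_measurable borel" unfolding R_def by measurable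
  \<comment> \<open>The growth condition survives rescaling by \<open>h\<close>, at the price of the
    factor 1 + h^4 in the constant.\<close>
  have scaled: "C * (1 + norm (h *\<^sub>R z) ^ 4) \<le> C * (1 + h ^ 4) * (1 + norm z ^ 4)" for h and z :: 'a
    using C by (simp add: power_mult_distrib mult.assoc mult_left_mono algebra_simps)
  have int_L: "integrable lborel (\<lambda>z. gauss z * L (h *\<^sub>R z))" for h
    by (rule gauss_integrable_mult) (auto intro: order_trans[OF L_bound scaled])
  have int_Q: "integrable lborel (\<lambda>z. gauss z * Q z)"
    by (rule gauss_integrable_mult) (auto intro: Q_bound)
  have R_scaled: "\<bar>R (h *\<^sub>R z)\<bar> \<le> C * h ^ 4 * norm z ^ 4" for h z
    using R_bound[of "h *\<^sub>R z"] by (simp add: R_def power_mult_distrib mult.assoc)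
  have int_R: "integrable lborel (\<lambda>z. gauss z * R (h *\<^sub>R z))" for h
    by (rule gauss_integrable_mult[where C="C * h ^ 4"])
       (auto intro!: order_trans[OF R_scaled] mult_left_mono simp: C)
  have gauss1: "integrable lborel (gauss :: 'a \<Rightarrow> real)" "(\<integral>z. gauss (z::'a) \<partial>lborel) = 1"
    using has_bochner_integral_gauss[where 'a='a] by (simp_all add: has_bochner_integral_iff)
  \<comment> \<open>Homogeneity of \<open>Q\<close> pulls out h^2. After integration the four
    summands give p x, zero, \<mu> h^2 and the remainder.\<close>
  have split: "gauss z * p (x + h *\<^sub>R z)
      = gauss z * p x + gauss z * L (h *\<^sub>R z) + h\<^sup>2 * (gauss z * Q z) + gauss z * R (h *\<^sub>R z)" for h z
    by (simp add: R_def Q_hom algebra_simps)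
  show thesis
  proof (rule that[of "C * m4" \<mu>])
    show "0 \<le> C * m4"
      unfolding m4_def using C gauss_pos by (auto intro!: mult_nonneg_nonneg integral_nonneg_AE less_imp_le[OF gauss_pos])
    fix h :: real
    show "integrable lborel (\<lambda>z. gauss z * p (x + h *\<^sub>R z))"
      unfolding split by (intro Bochner_Integration.integrable_add integrable_mult_right integrable_mult_left
          int_L int_Q int_R gauss1)
    have "(\<integral>z. gauss z * p (x + h *\<^sub>R z) \<partial>lborel)
        = p x + (\<integral>z. gauss z * L (h *\<^sub>R z) \<partial>lborel) + h\<^sup>2 * \<mu> + (\<integral>z. gauss z * R (h *\<^sub>R z) \<partial>lborel)"
      unfolding split by (simp add: int_L int_Q int_R gauss1 \<mu>_def)
    also have "(\<integral>z. gauss z * L (h *\<^sub>R z) \<partial>lborel) = 0"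
      by (rule integral_gauss_mult_odd) (auto simp: L_odd)
    finally have "(\<integral>z. gauss z * p (x + h *\<^sub>R z) \<partial>lborel) - p x - \<mu> * h\<^sup>2
        = (\<integral>z. gauss z * R (h *\<^sub>R z) \<partial>lborel)" by simp
    moreover have "norm (\<integral>z. gauss z * R (h *\<^sub>R z) \<partial>lborel)
        \<le> (\<integral>z. C * h ^ 4 * (gauss (z::'a) * norm z ^ 4) \<partial>lborel)"
    proof (rule Bochner_Integration.integral_norm_bound_integral[OF int_R])
      show "integrable lborel (\<lambda>z::'a. C * h ^ 4 * (gauss z * norm z ^ 4))"
        by (intro integrable_mult_right gauss_fourth_moment_integrable)
      show "norm (gauss z * R (h *\<^sub>R z)) \<le> C * h ^ 4 * (gauss z * norm z ^ 4)" for z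
        using mult_left_mono[OF R_scaled[of h z], of "gauss z"] gauss_pos[of z]
        by (simp add: abs_mult mult_ac)
    qed
    moreover have "(\<integral>z. C * h ^ 4 * (gauss (z::'a) * norm z ^ 4) \<partial>lborel) = C * m4 * h ^ 4"
      by (simp add: m4_def)
    ultimately show "\<bar>(\<integral>z. gauss z * p (x + h *\<^sub>R z) \<partial>lborel) - p x - \<mu> * h\<^sup>2\<bar> \<le> C * m4 * h ^ 4"
      by (simp only: real_norm_def)
  qed
qed

section \<open>Mean squared error of a sample mean\<close>

lemma (in prob_space) indep_var_expectation_mult:
  assumes "indep_vars (\<lambda>_. borel) X I" "i \<in> I" "j \<in> I" "i \<noteq> j"
    and "integrable M (X i)" "integrable M (X j :: _ \<Rightarrow> real)"
  shows "expectation (\<lambda>\<omega>. X i \<omega> * X j \<omega>) = expectation (X i) * expectation (X j)"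
proof -
  have "indep_vars (\<lambda>_. borel) X {i, j}"
    using assms by (intro indep_vars_subset[OF assms(1)]) auto
  from indep_vars_lebesgue_integral[OF _ this] show ?thesis
    using assms by auto
qed

text \<open>Bias-variance decomposition: independence kills the off-diagonal terms of the squared
  centred sum, leaving n variances. Each variance is bounded by the second moment, which is easier
  to control for a kernel.\<close>

lemma (in prob_space) mean_squared_error_sample_mean_le:
  fixes Y :: "nat \<Rightarrow> 'a \<Rightarrow> real"
  assumes indep: "indep_vars (\<lambda>_. borel) Y {1..n}" and n: "1 \<le> n"
    and int_sq: "\<And>i. i \<in> {1..n} \<Longrightarrow> integrable M (\<lambda>\<omega>. (Y i \<omega>)\<^sup>2)"
    and mean: "\<And>i. i \<in> {1..n} \<Longrightarrow> expectation (Y i) = m"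
    and second: "\<And>i. i \<in> {1..n} \<Longrightarrow> expectation (\<lambda>\<omega>. (Y i \<omega>)\<^sup>2) \<le> s"
  shows "expectation (\<lambda>\<omega>. (1 / real n * (\<Sum>i=1..n. Y i \<omega>) - t)\<^sup>2) \<le> s / real n + (m - t)\<^sup>2"
proof -
  define I where "I = {1..n}"
  have meas: "Y i \<in> borel_measurable M" if "i \<in> I" for i
    using indep that by (auto simp: indep_vars_def I_def)
  have int: "integrable M (Y i)" if "i \<in> I" for i
    using square_integrable_imp_integrable[OF meas[OF that]] int_sq that by (simp add: I_def)
  define Z where "Z i \<omega> = Y i \<omega> - m" for i \<omega>
  have indep_Z: "indep_vars (\<lambda>_. borel) Z I"
    unfolding Z_def I_def by (rule indep_vars_compose2[OF indep, of "\<lambda>_ y. y - m"]) auto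
  have int_Z: "integrable M (Z i)" and mean_Z: "expectation (Z i) = 0" if "i \<in> I" for i
    using int[OF that] mean that by (auto simp: Z_def[abs_def] I_def prob_space)
  have sq_Z: "(Z i \<omega>)\<^sup>2 = (Y i \<omega>)\<^sup>2 - 2 * m * Y i \<omega> + m\<^sup>2" for i \<omega>
    by (simp add: Z_def power2_eq_square algebra_simps)
  have int_sq_Z: "integrable M (\<lambda>\<omega>. (Z i \<omega>)\<^sup>2)" if "i \<in> I" for i
    unfolding sq_Z using int[OF that] int_sq that by (auto simp: I_def)
  have var_Z: "expectation (\<lambda>\<omega>. (Z i \<omega>)\<^sup>2) \<le> s" if "i \<in> I" for i
  proof -
    have "expectation (\<lambda>\<omega>. (Z i \<omega>)\<^sup>2) = expectation (\<lambda>\<omega>. (Y i \<omega>)\<^sup>2) - m\<^sup>2"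
      unfolding sq_Z using int[OF that] int_sq mean that by (simp add: I_def prob_space power2_eq_square)
    also have "\<dots> \<le> s" using second[of i] that zero_le_power2[of m] unfolding I_def by linarith
    finally show ?thesis .
  qed
  have int_ZZ: "integrable M (\<lambda>\<omega>. Z i \<omega> * Z j \<omega>)" if "i \<in> I" "j \<in> I" for i j
  proof (cases "i = j")
    case True
    then show ?thesis using int_sq_Z[OF that(1)] by (simp add: power2_eq_square)
  next
    case False
    have "indep_vars (\<lambda>_. borel) Z {i, j}"
      using that by (intro indep_vars_subset[OF indep_Z]) auto
    from indep_vars_integrable[OF _ this] show ?thesis
      using int_Z that False by auto
  qed
  have mean_ZZ: "expectation (\<lambda>\<omega>. Z i \<omega> * Z j \<omega>) = (if i = j then expectation (\<lambda>\<omega>. (Z i \<omega>)\<^sup>2) else 0)"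
    if "i \<in> I" "j \<in> I" for i j
    using indep_var_expectation_mult[OF indep_Z that] int_Z mean_Z that
    by (auto simp: power2_eq_square)
  have sum_sq: "(\<Sum>i\<in>I. Z i \<omega>)\<^sup>2 = (\<Sum>i\<in>I. \<Sum>j\<in>I. Z i \<omega> * Z j \<omega>)" for \<omega>
    by (simp add: power2_eq_square sum_product)
  have int_sum_sq: "integrable M (\<lambda>\<omega>. (\<Sum>i\<in>I. Z i \<omega>)\<^sup>2)"
    unfolding sum_sq by (intro Bochner_Integration.integrable_sum int_ZZ)
  have int_sum: "integrable M (\<lambda>\<omega>. \<Sum>i\<in>I. Z i \<omega>)"
    by (intro Bochner_Integration.integrable_sum int_Z)
  have mean_sum: "expectation (\<lambda>\<omega>. \<Sum>i\<in>I. Z i \<omega>) = 0"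
    using int_Z mean_Z by (subst Bochner_Integration.integral_sum) auto
  have "expectation (\<lambda>\<omega>. (\<Sum>i\<in>I. Z i \<omega>)\<^sup>2) = (\<Sum>i\<in>I. \<Sum>j\<in>I. expectation (\<lambda>\<omega>. Z i \<omega> * Z j \<omega>))"
    unfolding sum_sq
    by (simp add: int_ZZ)
  also have "\<dots> = (\<Sum>i\<in>I. expectation (\<lambda>\<omega>. (Z i \<omega>)\<^sup>2))"
  proof (rule sum.cong[OF refl])
    fix i assume i: "i \<in> I"
    then have "(\<Sum>j\<in>I. expectation (\<lambda>\<omega>. Z i \<omega> * Z j \<omega>))
        = (\<Sum>j\<in>I. if i = j then expectation (\<lambda>\<omega>. (Z i \<omega>)\<^sup>2) else 0)"
      by (intro sum.cong mean_ZZ) auto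
    also have "\<dots> = expectation (\<lambda>\<omega>. (Z i \<omega>)\<^sup>2)"
      using i by (simp add: I_def)
    finally show "(\<Sum>j\<in>I. expectation (\<lambda>\<omega>. Z i \<omega> * Z j \<omega>)) = expectation (\<lambda>\<omega>. (Z i \<omega>)\<^sup>2)" .
  qed
  also have "\<dots> \<le> real n * s"
    using sum_bounded_above[of I "\<lambda>i. expectation (\<lambda>\<omega>. (Z i \<omega>)\<^sup>2)" s] var_Z by (simp add: I_def)
  finally have var_sum: "expectation (\<lambda>\<omega>. (\<Sum>i\<in>I. Z i \<omega>)\<^sup>2) \<le> real n * s" .
  have "1 / real n * (\<Sum>i=1..n. Y i \<omega>) = 1 / real n * (\<Sum>i\<in>I. Z i \<omega>) + m" for \<omega>
    using n by (simp add: Z_def I_def sum_subtractf field_simps)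
  \<comment> \<open>Expansion of the square around the mean m; the middle term has expectation zero
    because the \<open>Z i\<close> are centred.\<close>
  then have "(1 / real n * (\<Sum>i=1..n. Y i \<omega>) - t)\<^sup>2
      = (1 / real n)\<^sup>2 * (\<Sum>i\<in>I. Z i \<omega>)\<^sup>2 + 2 * (m - t) / real n * (\<Sum>i\<in>I. Z i \<omega>) + (m - t)\<^sup>2" for \<omega>
    by (simp add: power2_eq_square algebra_simps diff_divide_distrib)
  then have "expectation (\<lambda>\<omega>. (1 / real n * (\<Sum>i=1..n. Y i \<omega>) - t)\<^sup>2)
      = (1 / real n)\<^sup>2 * expectation (\<lambda>\<omega>. (\<Sum>i\<in>I. Z i \<omega>)\<^sup>2) + (m - t)\<^sup>2"
    using int_sum int_sum_sq mean_sum by (simp add: prob_space)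
  also have "\<dots> \<le> (1 / real n)\<^sup>2 * (real n * s) + (m - t)\<^sup>2"
    using var_sum by (intro add_right_mono mult_left_mono) auto
  finally show ?thesis using n by (simp add: power2_eq_square)
qed

section \<open>The rescaled kernel and its expectation\<close>

text \<open>The normalization by h^d is put inside the summand, so that the estimator becomes a
  plain sample mean of transformed observations.\<close>

definition gauss_kernel :: "real \<Rightarrow> 'a::euclidean_space \<Rightarrow> 'a \<Rightarrow> real" where
  "gauss_kernel h x y = gauss ((1 / h) *\<^sub>R (x - y)) / h ^ DIM('a)"

lemma borel_measurable_gauss_kernel [measurable]: "gauss_kernel h x \<in> borel_measurable borel"
  unfolding gauss_kernel_def by measurable

lemma gauss_kernel_bounds:
  fixes x :: "'a::euclidean_space"
  assumes "0 < h"
  shows "0 \<le> gauss_kernel h x y" "gauss_kernel h x y \<le> gauss (0 :: 'a) / h ^ DIM('a)"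
  using assms by (simp_all add: gauss_kernel_def divide_right_mono gauss_le_gauss_0 less_imp_le[OF gauss_pos])

lemma gaussian_kde_eq_mean_gauss_kernel:
  assumes "0 < h"
  shows "gaussian_kde X n h x = 1 / real n * (\<Sum>i=1..n. gauss_kernel h x (X i))"
proof -
  have "(norm (x - X i) / h)\<^sup>2 = (norm ((1 / h) *\<^sub>R (x - X i)))\<^sup>2" for i
    using assms by simp
  then show ?thesis
    unfolding gaussian_kde_def gauss_kernel_def gauss_def
    by (simp add: sum_divide_distrib[symmetric] mult.commute)
qed

text \<open>Under y = x + h z the Jacobian h^d cancels the normalization of the kernel, whose
  argument becomes -z; evenness of \<open>gauss\<close> removes the sign.\<close>

lemma expectation_gauss_kernel:
  fixes p :: "'a::euclidean_space \<Rightarrow> real" and X :: "'w \<Rightarrow> 'a"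
  assumes "distributed M lborel X (\<lambda>y. ennreal (p y))" "\<And>y. 0 \<le> p y"
    and [measurable]: "p \<in> borel_measurable borel" and "0 < h"
  shows "(\<integral>\<omega>. gauss_kernel h x (X \<omega>) \<partial>M) = (\<integral>z. gauss z * p (x + h *\<^sub>R z) \<partial>lborel)"
proof -
  have "(\<integral>\<omega>. gauss_kernel h x (X \<omega>) \<partial>M) = (\<integral>y. p y * gauss_kernel h x y \<partial>lborel)"
    using assms by (intro distributed_integral[symmetric]) auto
  also have "\<dots> = \<bar>h\<bar> ^ DIM('a) * (\<integral>z. p (x + h *\<^sub>R z) * gauss_kernel h x (x + h *\<^sub>R z) \<partial>lborel)"
    using \<open>0 < h\<close> by (intro lborel_integral_affine) auto
  also have "\<dots> = (\<integral>z. \<bar>h\<bar> ^ DIM('a) * (p (x + h *\<^sub>R z) * gauss_kernel h x (x + h *\<^sub>R z)) \<partial>lborel)"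
    by simp
  also have "\<dots> = (\<integral>z. gauss z * p (x + h *\<^sub>R z) \<partial>lborel)"
    using \<open>0 < h\<close> by (intro Bochner_Integration.integral_cong) (auto simp: gauss_kernel_def)
  finally show ?thesis .
qed

section \<open>The weights and the convergence rate\<close>

text \<open>Uniqueness is already known, so the definite description is evaluated by checking that
  the candidate solves both equations.\<close>

lemma kde_weights_eq:
  assumes "h1\<^sup>2 \<noteq> h2\<^sup>2"
  shows "kde_weights h1 h2 = (h2\<^sup>2 / (h2\<^sup>2 - h1\<^sup>2), - h1\<^sup>2 / (h2\<^sup>2 - h1\<^sup>2))"
  unfolding kde_weights_def
proof (rule the1_equality[OF kde_weights_ex1[OF assms]])
  have "h2\<^sup>2 - h1\<^sup>2 \<noteq> 0" using assms by simp
  then show "fst (h2\<^sup>2 / (h2\<^sup>2 - h1\<^sup>2), - h1\<^sup>2 / (h2\<^sup>2 - h1\<^sup>2)) + snd (h2\<^sup>2 / (h2\<^sup>2 - h1\<^sup>2), - h1\<^sup>2 / (h2\<^sup>2 - h1\<^sup>2)) = 1 \<and>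
      fst (h2\<^sup>2 / (h2\<^sup>2 - h1\<^sup>2), - h1\<^sup>2 / (h2\<^sup>2 - h1\<^sup>2)) * h1\<^sup>2 + snd (h2\<^sup>2 / (h2\<^sup>2 - h1\<^sup>2), - h1\<^sup>2 / (h2\<^sup>2 - h1\<^sup>2)) * h2\<^sup>2 = 0"
    by (simp add: diff_divide_distrib[symmetric])
qed

theorem mainTheorem3:
  fixes p :: "'a::euclidean_space \<Rightarrow> real"
    and M :: "'w measure"
    and X :: "nat \<Rightarrow> 'w \<Rightarrow> 'a"
    and a1 a2 :: real
    and h1 h2 :: "nat \<Rightarrow> real"
    and x :: 'a
  assumes p_nonneg: "\<And>y. 0 \<le> p y"
    and p_density: "(\<integral>\<^sup>+ y. ennreal (p y) \<partial>lborel) = 1"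
    and p_smooth: "four_times_differentiable_bounded p"
    and M: "prob_space M"
    and X_indep: "prob_space.indep_vars M (\<lambda>_. borel) X {1..}"
    and X_distr: "\<And>i. i \<ge> 1 \<Longrightarrow> distributed M lborel (X i) (\<lambda>y. ennreal (p y))"
    and a: "0 < a1" "a1 < a2"
    and h1: "\<And>n. n \<ge> 1 \<Longrightarrow> h1 n = a1 * real n powr (- 1 / real (DIM('a) + 8))"
    and h2: "\<And>n. n \<ge> 1 \<Longrightarrow> h2 n = a2 * real n powr (- 1 / real (DIM('a) + 8))"
  shows "(\<lambda>n. prob_space.expectation M
            (\<lambda>\<omega>. (combined_kde (\<lambda>i. X i \<omega>) n (h1 n) (h2 n) x - p x)\<^sup>2))
         \<in> O(\<lambda>n. real n powr (- 8 / real (DIM('a) + 8)))"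
proof -
  interpret prob_space M by (rule M)
  define d where "d = DIM('a)"
  define r where "r n = real n powr (- 1 / real (d + 8))" for n
  \<comment> \<open>The weights are unchanged when both bandwidths are multiplied by the same
    factor. Hence \<open>r n\<close> cancels and these two constants serve for all n.\<close>
  define A1 A2 where "A1 = a2\<^sup>2 / (a2\<^sup>2 - a1\<^sup>2)" and "A2 = - a1\<^sup>2 / (a2\<^sup>2 - a1\<^sup>2)"
  have sq: "a1\<^sup>2 < a2\<^sup>2" using a by (intro power_strict_mono) auto
  have A_sum: "A1 + A2 = 1" and A_sq: "A1 * a1\<^sup>2 + A2 * a2\<^sup>2 = 0"
    using sq by (simp_all add: A1_def A2_def diff_divide_distrib[symmetric])
  obtain \<mu> B where B: "0 \<le> B"
    and expansion: "\<And>h. \<bar>(\<integral>z. gauss z * p (x + h *\<^sub>R z) \<partial>lborel) - p x - \<mu> * h\<^sup>2\<bar> \<le> B * h ^ 4"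
    by (rule gauss_smoothing_expansion[OF p_smooth, of x]) blast
  define m where "m h = (\<integral>z. gauss z * p (x + h *\<^sub>R z) \<partial>lborel)" for h
  have p_meas: "p \<in> borel_measurable borel"
    by (rule four_times_differentiable_bounded_borel_measurable[OF p_smooth])
  \<comment> \<open>A bound for the mean of the estimator that is uniform over bandwidths in (0,
    a2]. Both bandwidths lie in this range because r n is at most 1.\<close>
  define H where "H = p x + \<bar>\<mu>\<bar> * a2\<^sup>2 + B * a2 ^ 4"
  have m_le: "m h \<le> H" if "0 < h" "h \<le> a2" for h
  proof -
    have "m h \<le> p x + \<mu> * h\<^sup>2 + B * h ^ 4"
      using expansion[of h] by (simp add: m_def abs_le_iff)
    also have "\<mu> * h\<^sup>2 \<le> \<bar>\<mu>\<bar> * a2\<^sup>2"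
      using that by (intro mult_mono power_mono) auto
    also have "B * h ^ 4 \<le> B * a2 ^ 4"
      using that B by (intro mult_left_mono power_mono) auto
    finally show ?thesis by (simp add: H_def)
  qed
  have H: "0 \<le> H"
    using p_nonneg[of x] B a by (simp add: H_def)
  define G where "G = gauss (0 :: 'a)"
  have G: "0 < G" by (simp add: G_def gauss_pos)
  \<comment> \<open>\<open>K\<close> bounds the second moment of a summand after q^(-d) is factored
    out: 2 comes from (u + v)^2 \<le> 2 u^2 + 2 v^2, \<open>G\<close> from the height of the kernel,
    \<open>H\<close> from its mean. \<open>D\<close> adds up the fourth order bias errors with the
    absolute values of the weights.\<close>
  define K where "K = 2 * G * H * (A1\<^sup>2 / a1 ^ d + A2\<^sup>2 / a2 ^ d)"
  define D where "D = B * (\<bar>A1\<bar> * a1 ^ 4 + \<bar>A2\<bar> * a2 ^ 4)"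
  have X_meas [measurable]: "X i \<in> borel_measurable M" if "i \<ge> 1" for i
    using distributed_measurable[OF X_distr[OF that]] by simp
  have mse: "expectation (\<lambda>\<omega>. (combined_kde (\<lambda>i. X i \<omega>) n (h1 n) (h2 n) x - p x)\<^sup>2) \<le> (K + D\<^sup>2) * r n ^ 8"
    if n: "1 \<le> n" for n
  proof -
    define q where "q = r n"
    have q: "0 < q" using n by (simp add: q_def r_def)
    have "q \<le> 1" using n powr_mono[of "- 1 / real (d + 8)" 0 "real n"] by (simp add: q_def r_def)
    \<comment> \<open>Writing 1 / n as a natural power of q turns the whole rate computation into
      arithmetic of powers of q.\<close>
    have "q ^ (d + 8) = real n powr (- 1 / real (d + 8) * real (d + 8))"
      using q by (simp add: powr_realpow[symmetric] q_def r_def powr_powr del: of_nat_add power_add)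
    also have "- 1 / real (d + 8) * real (d + 8) = - 1" by simp
    finally have inv_n: "1 / real n = q ^ (d + 8)"
      using n by (simp add: powr_minus_divide)
    have h: "h1 n = a1 * q" "h2 n = a2 * q" using h1[OF n] h2[OF n] by (simp_all add: q_def r_def d_def)
    have h_pos: "0 < h1 n" "0 < h2 n" using h q a by simp_all
    have "a1 * q \<le> a2 * 1" "a2 * q \<le> a2 * 1" using a q \<open>q \<le> 1\<close> by (intro mult_mono; simp)+
    then have h_le: "h1 n \<le> a2" "h2 n \<le> a2" by (simp_all add: h)
    have ne: "(h1 n)\<^sup>2 \<noteq> (h2 n)\<^sup>2" using sq q by (simp add: h power_mult_distrib)
    have "kde_weights (h1 n) (h2 n) = (A1, A2)"
      unfolding kde_weights_eq[OF ne] using q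
      by (simp add: h A1_def A2_def power_mult_distrib left_diff_distrib[symmetric])
    define k1 k2 where "k1 = gauss_kernel (h1 n) x" and "k2 = gauss_kernel (h2 n) x"
    have [measurable]: "k1 \<in> borel_measurable borel" "k2 \<in> borel_measurable borel"
      by (simp_all add: k1_def k2_def)
    define s1 s2 where "s1 = G / h1 n ^ d" and "s2 = G / h2 n ^ d"
    have s: "0 \<le> s1" "0 \<le> s2" using G h_pos by (simp_all add: s1_def s2_def)
    have k: "0 \<le> k1 y" "k1 y \<le> s1" "0 \<le> k2 y" "k2 y \<le> s2" for y
      using gauss_kernel_bounds h_pos by (simp_all add: k1_def k2_def s1_def s2_def G_def d_def)
    \<comment> \<open>The combined estimator is itself a sample mean, of a signed kernel since
      \<open>A2\<close> is negative. The mean squared error bound thus applies to it at once,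
      instead of to the two estimators separately.\<close>
    define Y where "Y i \<omega> = A1 * k1 (X i \<omega>) + A2 * k2 (X i \<omega>)" for i \<omega>
    have kde: "combined_kde (\<lambda>i. X i \<omega>) n (h1 n) (h2 n) x = 1 / real n * (\<Sum>i=1..n. Y i \<omega>)" for \<omega>
      unfolding combined_kde_def \<open>kde_weights (h1 n) (h2 n) = (A1, A2)\<close>
        gaussian_kde_eq_mean_gauss_kernel[OF h_pos(1)] gaussian_kde_eq_mean_gauss_kernel[OF h_pos(2)]
      by (simp add: Y_def k1_def k2_def sum.distrib sum_distrib_left distrib_left mult_ac)
    have int_k: "integrable M (\<lambda>\<omega>. k1 (X i \<omega>))" "integrable M (\<lambda>\<omega>. k2 (X i \<omega>))" if "i \<ge> 1" for i
      using X_meas[OF that] k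
      by (auto intro: integrable_const_bound[where B=s1] integrable_const_bound[where B=s2])
    have mean_k: "expectation (\<lambda>\<omega>. k1 (X i \<omega>)) = m (h1 n)" "expectation (\<lambda>\<omega>. k2 (X i \<omega>)) = m (h2 n)"
      if "i \<ge> 1" for i
      unfolding k1_def k2_def m_def
      by (rule expectation_gauss_kernel[OF X_distr[OF that] p_nonneg p_meas]; use h_pos in simp)+
    \<comment> \<open>One factor of each squared kernel is replaced by its maximum, which leaves a
      bound linear in the kernels, whose means are known.\<close>
    have Y_sq: "(Y i \<omega>)\<^sup>2 \<le> 2 * A1\<^sup>2 * s1 * k1 (X i \<omega>) + 2 * A2\<^sup>2 * s2 * k2 (X i \<omega>)" for i \<omega>
    proof -
      have "(Y i \<omega>)\<^sup>2 \<le> 2 * (A1 * k1 (X i \<omega>))\<^sup>2 + 2 * (A2 * k2 (X i \<omega>))\<^sup>2"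
        using sum_squares_bound[of "A1 * k1 (X i \<omega>)" "A2 * k2 (X i \<omega>)"]
        by (simp add: Y_def power2_sum)
      also have "\<dots> = 2 * A1\<^sup>2 * (k1 (X i \<omega>) * k1 (X i \<omega>)) + 2 * A2\<^sup>2 * (k2 (X i \<omega>) * k2 (X i \<omega>))"
        by (simp add: power2_eq_square)
      also have "\<dots> \<le> 2 * A1\<^sup>2 * (s1 * k1 (X i \<omega>)) + 2 * A2\<^sup>2 * (s2 * k2 (X i \<omega>))"
        by (intro add_mono mult_left_mono mult_right_mono k) auto
      finally show ?thesis by (simp add: mult.assoc)
    qed
    have int_bound: "integrable M (\<lambda>\<omega>. 2 * A1\<^sup>2 * s1 * k1 (X i \<omega>) + 2 * A2\<^sup>2 * s2 * k2 (X i \<omega>))"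
      if "i \<ge> 1" for i
      using int_k[OF that] by simp
    have int_Y_sq: "integrable M (\<lambda>\<omega>. (Y i \<omega>)\<^sup>2)" if "i \<ge> 1" for i
    proof (rule Bochner_Integration.integrable_bound[OF int_bound[OF that]])
      show "(\<lambda>\<omega>. (Y i \<omega>)\<^sup>2) \<in> borel_measurable M"
        unfolding Y_def using X_meas[OF that] by measurable
      show "AE \<omega> in M. norm ((Y i \<omega>)\<^sup>2) \<le> norm (2 * A1\<^sup>2 * s1 * k1 (X i \<omega>) + 2 * A2\<^sup>2 * s2 * k2 (X i \<omega>))"
        using Y_sq[of i] by (auto intro: order_trans[OF _ abs_ge_self])
    qed
    have second: "expectation (\<lambda>\<omega>. (Y i \<omega>)\<^sup>2) \<le> K / q ^ d" if "i \<ge> 1" for i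
    proof -
      have "expectation (\<lambda>\<omega>. (Y i \<omega>)\<^sup>2)
          \<le> expectation (\<lambda>\<omega>. 2 * A1\<^sup>2 * s1 * k1 (X i \<omega>) + 2 * A2\<^sup>2 * s2 * k2 (X i \<omega>))"
        by (rule integral_mono[OF int_Y_sq[OF that] int_bound[OF that] Y_sq])
      also have "\<dots> = 2 * A1\<^sup>2 * s1 * m (h1 n) + 2 * A2\<^sup>2 * s2 * m (h2 n)"
        using int_k[OF that] mean_k[OF that] by simp
      also have "\<dots> \<le> 2 * A1\<^sup>2 * s1 * H + 2 * A2\<^sup>2 * s2 * H"
        using s h_pos h_le by (intro add_mono mult_left_mono m_le) auto
      also have "\<dots> = K / q ^ d"
        by (simp add: K_def s1_def s2_def h power_mult_distrib add_divide_distrib distrib_left mult_ac)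
      finally show ?thesis .
    qed
    have "expectation (\<lambda>\<omega>. (1 / real n * (\<Sum>i=1..n. Y i \<omega>) - p x)\<^sup>2)
        \<le> K / q ^ d / real n + (A1 * m (h1 n) + A2 * m (h2 n) - p x)\<^sup>2"
    proof (rule mean_squared_error_sample_mean_le[OF _ n])
      have "indep_vars (\<lambda>_. borel) X {1..n}"
        by (rule indep_vars_subset[OF X_indep]) auto
      then show "indep_vars (\<lambda>_. borel) Y {1..n}"
        unfolding Y_def by (rule indep_vars_compose2[where Y="\<lambda>_ y. A1 * k1 y + A2 * k2 y"]) auto
    next
      fix i assume "i \<in> {1..n}"
      then have i: "i \<ge> 1" by simp
      show "integrable M (\<lambda>\<omega>. (Y i \<omega>)\<^sup>2)" by (rule int_Y_sq[OF i])
      show "expectation (Y i) = A1 * m (h1 n) + A2 * m (h2 n)"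
        unfolding Y_def using int_k[OF i] mean_k[OF i] by simp
      show "expectation (\<lambda>\<omega>. (Y i \<omega>)\<^sup>2) \<le> K / q ^ d" by (rule second[OF i])
    qed
    \<comment> \<open>The variance part: q^(-d) times q^(d + 8).\<close>
    also have "K / q ^ d / real n = K * q ^ 8"
      using inv_n q by (simp add: divide_inverse power_add)
    also have "(A1 * m (h1 n) + A2 * m (h2 n) - p x)\<^sup>2 \<le> (D * q ^ 4)\<^sup>2"
    proof -
      \<comment> \<open>The squared bias part. The second weight equation removes the \<mu> terms,
        and the first one distributes p x over the two estimators, so only the two fourth order
        errors remain.\<close>
      have "A1 * (h1 n)\<^sup>2 + A2 * (h2 n)\<^sup>2 = (A1 * a1\<^sup>2 + A2 * a2\<^sup>2) * q\<^sup>2"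
        by (simp add: h power_mult_distrib algebra_simps)
      then have "\<mu> * (A1 * (h1 n)\<^sup>2 + A2 * (h2 n)\<^sup>2) = 0" by (simp add: A_sq)
      moreover have "p x = (A1 + A2) * p x" by (simp add: A_sum)
      ultimately have "A1 * m (h1 n) + A2 * m (h2 n) - p x
          = A1 * (m (h1 n) - p x - \<mu> * (h1 n)\<^sup>2) + A2 * (m (h2 n) - p x - \<mu> * (h2 n)\<^sup>2)"
        by (simp add: algebra_simps)
      also have "\<bar>\<dots>\<bar> \<le> \<bar>A1\<bar> * (B * h1 n ^ 4) + \<bar>A2\<bar> * (B * h2 n ^ 4)"
        unfolding m_def
        by (intro order_trans[OF abs_triangle_ineq] add_mono) (auto simp: abs_mult intro!: mult_left_mono expansion)
      also have "\<dots> = D * q ^ 4"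
        by (simp add: D_def h power_mult_distrib algebra_simps)
      finally show ?thesis by (rule power2_le_iff_abs_le[THEN iffD2, rotated]) (use B q a in \<open>simp add: D_def\<close>)
    qed
    finally show ?thesis
      unfolding kde by (simp add: q_def power_mult_distrib power_mult[symmetric] distrib_right)
  qed
  have rate: "r n ^ 8 = real n powr (- 8 / real (DIM('a) + 8))" if "1 \<le> n" for n
    using that by (simp add: r_def d_def powr_realpow[symmetric] powr_powr)
  show ?thesis
  \<comment> \<open>The bound starts at n = 1, since the hypotheses fix the bandwidths only from
    there on.\<close>
  proof (rule bigoI[where c="K + D\<^sup>2"], rule eventually_mono[OF eventually_ge_at_top[of 1]])
    fix n :: nat assume n: "1 \<le> n"
    show "norm (expectation (\<lambda>\<omega>. (combined_kde (\<lambda>i. X i \<omega>) n (h1 n) (h2 n) x - p x)\<^sup>2))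
        \<le> (K + D\<^sup>2) * norm (real n powr (- 8 / real (DIM('a) + 8)))"
      using mse[OF n] rate[OF n] by simp
  qed
qed

end
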